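(* Fix an integer $r\ge 1$ and let $\mathcal{T}_h$ be a shape-regular triangulation of $\Omega\subset\mathbb{R}^3$ into tetrahedra. For $K\in\mathcal{T}_h$ let $\bm{D}_h(K)=[P_{r-1}(K)]^3$ and let $\bm{B}_h^{\mathrm{div}}(K)$ be the $\bm{H}(\mathrm{div})$ bubble space on $K$ defined in the context. Then there is a constant $c>0$, independent of $h_K$, such that for every $K\in\mathcal{T}_h$ $$\inf_{0\ne \bm{q}_h\in \bm{D}_h(K)}\ \sup_{0\ne \bm{v}_h\in \bm{B}_h^{\mathrm{div}}(K)}\ \frac{(\bm{v}_h,\bm{q}_h)_K}{\|\bm{v}_h\|_{0,K}\,\|\bm{q}_h\|_{0,K}}\ \ge\ c\ >0 .$$
   Context: $(\cdot,\cdot)_K$ and $\|\cdot\|_{0,K}$ are the $L^2$ inner product and norm on $K$ (for vector fields), $h_K$ is the diameter of $K$, and $P_{m}(K)$ is the space of polynomials of degree at most $m$ on $K$. Constants may depend on the shape-regularity of the triangulation and on the fixed $r$. For a tetrahedron $K$ with vertices numbered $0,1,2,3$, let $\lambda_0,\lambda_1,\lambda_2,\lambda_3$ be the barycentric coordinates associated with the vertices, and let $\bm{t}_{0i}$ ($i=1,2,3$) be the unit tangent vector along the edge from vertex $0$ to vertex $i$ (the choice of the common vertex, i.e. of the numbering, is arbitrary). Put $$\bm{b}_1^{\rm div}=\lambda_0\lambda_1\,\bm{t}_{01},\quad \bm{b}_2^{\rm div}=\lambda_0\lambda_2\,\bm{t}_{02},\quad \bm{b}_3^{\rm div}=\lambda_0\lambda_3\,\bm{t}_{03},$$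 and $$\bm{B}_h^{\mathrm{div}}(K)=P_{r-1}(K)\bm{b}_1^{\rm div}+P_{r-1}(K)\bm{b}_2^{\rm div}+P_{r-1}(K)\bm{b}_3^{\rm div}.$$ *)

theory Defs
  imports "HOL-Analysis.Analysis"
begin

definition tetrahedral_mesh :: "(real^3) set set \<Rightarrow> (real^3) set \<Rightarrow> bool" where
  "tetrahedral_mesh \<T> \<Omega> \<longleftrightarrow>
     triangulation \<T> \<and> (\<forall>K\<in>\<T>. 3 simplex K) \<and> \<Union>\<T> = closure \<Omega>"

definition inball_diameter :: "(real^3) set \<Rightarrow> real" where
  "inball_diameter K = Sup {2 * \<rho> | \<rho>. 0 \<le> \<rho> \<and> (\<exists>x. cball x \<rho> \<subseteq> K)}"

definition shape_regular :: "real \<Rightarrow> (real^3) set set \<Rightarrow> bool" where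
  "shape_regular \<sigma> \<T> \<longleftrightarrow> (\<forall>K\<in>\<T>. diameter K \<le> \<sigma> * inball_diameter K)"

definition vertex_numbering :: "(4 \<Rightarrow> real^3) \<Rightarrow> (real^3) set \<Rightarrow> bool" where
  "vertex_numbering a K \<longleftrightarrow> bij_betw a UNIV {x. x extreme_point_of K}"

(* Well defined for every point of the space when the four points are affinely independent. *)
definition barycentric :: "(4 \<Rightarrow> real^3) \<Rightarrow> 4 \<Rightarrow> real^3 \<Rightarrow> real" where
  "barycentric a i x =
     (THE l :: 4 \<Rightarrow> real. (\<Sum>j\<in>UNIV. l j) = 1 \<and> (\<Sum>j\<in>UNIV. l j *\<^sub>R a j) = x) i"

definition unit_tangent :: "(4 \<Rightarrow> real^3) \<Rightarrow> 4 \<Rightarrow> 4 \<Rightarrow> real^3" where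
  "unit_tangent a i j = (a j - a i) /\<^sub>R norm (a j - a i)"

definition monomial :: "(3 \<Rightarrow> nat) \<Rightarrow> real^3 \<Rightarrow> real" where
  "monomial \<alpha> x = (\<Prod>i\<in>UNIV. (x $ i) ^ \<alpha> i)"

lemma finite_multiindices: "finite {\<alpha> :: 3 \<Rightarrow> nat. (\<Sum>i\<in>UNIV. \<alpha> i) \<le> m}"
proof (rule finite_subset)
  show "{\<alpha> :: 3 \<Rightarrow> nat. (\<Sum>i\<in>UNIV. \<alpha> i) \<le> m} \<subseteq> PiE UNIV (\<lambda>_. {..m})"
  proof
    fix \<alpha> :: "3 \<Rightarrow> nat" assume "\<alpha> \<in> {\<alpha>. (\<Sum>i\<in>UNIV. \<alpha> i) \<le> m}"
    moreover have "\<alpha> i \<le> (\<Sum>i\<in>UNIV. \<alpha> i)" for i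
      by (rule member_le_sum) simp_all
    ultimately have "\<alpha> i \<le> m" for i
      by (metis mem_Collect_eq order_trans)
    then show "\<alpha> \<in> PiE UNIV (\<lambda>_. {..m})"
      by (simp add: PiE_def Pi_def)
  qed
  show "finite (PiE (UNIV :: 3 set) (\<lambda>_. {..m}))"
    by (rule finite_PiE) simp_all
qed

(* A function on K is represented by its extension by 0 outside K, so that it is nonzero
   as a function on K exactly when it differs from the constant function 0. *)
definition poly_space :: "nat \<Rightarrow> (real^3) set \<Rightarrow> (real^3 \<Rightarrow> real) set" where
  "poly_space m K =
     {p. (\<exists>c. \<forall>x\<in>K. p x = (\<Sum>\<alpha> | (\<Sum>i\<in>UNIV. \<alpha> i) \<le> m. c \<alpha> * monomial \<alpha> x)) \<and>
         (\<forall>x. x \<notin> K \<longrightarrow> p x = 0)}"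

definition D_space :: "nat \<Rightarrow> (real^3) set \<Rightarrow> (real^3 \<Rightarrow> real^3) set" where
  "D_space r K = {q. \<forall>i. (\<lambda>x. q x $ i) \<in> poly_space (r - 1) K}"

definition div_bubble :: "(4 \<Rightarrow> real^3) \<Rightarrow> 4 \<Rightarrow> real^3 \<Rightarrow> real^3" where
  "div_bubble a i x = (barycentric a 0 x * barycentric a i x) *\<^sub>R unit_tangent a 0 i"

definition B_div_space ::
  "nat \<Rightarrow> (4 \<Rightarrow> real^3) \<Rightarrow> (real^3) set \<Rightarrow> (real^3 \<Rightarrow> real^3) set" where
  "B_div_space r a K =
     {\<lambda>x. p\<^sub>1 x *\<^sub>R div_bubble a 1 x + p\<^sub>2 x *\<^sub>R div_bubble a 2 x + p\<^sub>3 x *\<^sub>R div_bubble a 3 x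
      | p\<^sub>1 p\<^sub>2 p\<^sub>3. p\<^sub>1 \<in> poly_space (r - 1) K \<and> p\<^sub>2 \<in> poly_space (r - 1) K \<and> p\<^sub>3 \<in> poly_space (r - 1) K}"

definition L2_inner :: "(real^3) set \<Rightarrow> (real^3 \<Rightarrow> real^3) \<Rightarrow> (real^3 \<Rightarrow> real^3) \<Rightarrow> real" where
  "L2_inner K v q = (LINT x:K|lborel. v x \<bullet> q x)"

definition L2_norm :: "(real^3) set \<Rightarrow> (real^3 \<Rightarrow> real^3) \<Rightarrow> real" where
  "L2_norm K v = sqrt (L2_inner K v v)"

(* The infimum and supremum are taken in the extended reals, where both always exist. *)
definition inf_sup :: "(real^3) set \<Rightarrow> (real^3 \<Rightarrow> real^3) set \<Rightarrow> (real^3 \<Rightarrow> real^3) set \<Rightarrow> ereal" where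
  "inf_sup K D B =
     (INF q \<in> D - {\<lambda>x. 0}. SUP v \<in> B - {\<lambda>x. 0}.
        ereal (L2_inner K v q / (L2_norm K v * L2_norm K q)))"

end

theory Submission
  imports Defs
begin

text \<open>
  Given a nonzero \<open>q\<close>, the bubble function \<open>v = \<Sum>\<^sub>i (q \<bullet> t\<^sub>i) b\<^sub>i\<close> (where
  \<open>t\<^sub>i\<close> is the unit tangent of the edge from vertex \<open>0\<close> to vertex \<open>i\<close>) is a suitable test
  function. It satisfies
  \<open>(v, q) = \<Sum>\<^sub>i \<integral> \<lambda>\<^sub>0 \<lambda>\<^sub>i (q \<bullet> t\<^sub>i)\<^sup>2\<close>, and
  \<open>(v, v) \<le> 3 (v, q)\<close> because \<open>0 \<le> \<lambda>\<^sub>0 \<lambda>\<^sub>i \<le> 1\<close>. It remains to bound \<open>(q, q)\<close> by a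
  constant times \<open>(v, q)\<close>, and two independent facts give this.

  First, a polynomial \<open>p\<close> of bounded degree satisfies
  \<open>\<integral> p\<^sup>2 \<le> c \<integral> \<lambda>\<^sub>0 \<lambda>\<^sub>i p\<^sup>2\<close> with \<open>c\<close> depending only on the degree
  (\<open>polynomial_L2_le_weighted_L2\<close>). Instead of a scaling to a reference element and the equivalence of
  norms there, the proof extrapolates \<open>p\<close> along rays from the centroid: the value at a point
  of \<open>K\<close> is a fixed linear combination of the values at points at most half as far from the
  centroid, where \<open>\<lambda>\<^sub>0 \<lambda>\<^sub>i \<ge> 1/64\<close>, and dilations change integrals by known factors.

  Second, shape regularity makes the three tangents uniformly linearly independent. If \<open>K\<close> contains
  a ball whose radius is comparable to the diameter of \<open>K\<close>, then the components \<open>q \<bullet> t\<^sub>i\<close>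
  control \<open>q\<close> (\<open>norm_le_tangential_components\<close>): the diameter of that ball in the direction of
  \<open>q\<close> is a combination of the edge vectors with coefficients at most \<open>1\<close> in absolute value.
\<close>

section \<open>Polynomials on a dilated convex set\<close>

text \<open>
  Lagrange interpolation. The weights are the values at \<open>z\<close> of the Lagrange basis polynomials,
  so that they do not depend on \<open>p\<close>; here \<open>z\<close> will lie outside the convex hull of the nodes.
\<close>

lemma extrapolation_weights:
  fixes \<theta> :: "nat \<Rightarrow> real" and z :: real
  assumes inj: "inj_on \<theta> {..m}"
  obtains w where "\<And>p. degree p \<le> m \<Longrightarrow> poly p z = (\<Sum>j\<le>m. w j * poly p (\<theta> j))"
proof -
  define L where "L j = (\<Prod>k\<in>{..m}-{j}. [:- \<theta> k / (\<theta> j - \<theta> k), 1 / (\<theta> j - \<theta> k):])" for j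
  have deg_L: "degree (L j) \<le> m" if "j \<le> m" for j
  proof -
    have "degree (L j) \<le> (\<Sum>k\<in>{..m}-{j}. degree [:- \<theta> k / (\<theta> j - \<theta> k), 1 / (\<theta> j - \<theta> k):])"
      unfolding L_def by (rule order_trans[OF degree_prod_sum_le]) (simp_all add: o_def)
    also have "\<dots> \<le> (\<Sum>k\<in>{..m}-{j}. 1)" by (intro sum_mono) simp
    also have "\<dots> = m" using that by (simp add: card_Diff_singleton)
    finally show ?thesis .
  qed
  have poly_L: "poly (L j) (\<theta> i) = (if i = j then 1 else 0)" if "i \<le> m" "j \<le> m" for i j
  proof (cases "i = j")
    case True
    have "\<theta> k \<noteq> \<theta> j" if "k \<in> {..m} - {j}" for k
      using inj \<open>j \<le> m\<close> that by (auto dest: inj_onD)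
    then have "(\<Prod>k\<in>{..m}-{j}. poly [:- \<theta> k / (\<theta> j - \<theta> k), 1 / (\<theta> j - \<theta> k):] (\<theta> j)) = 1"
      by (intro prod.neutral) (force simp: field_simps)
    then show ?thesis using True by (simp add: L_def poly_prod)
  next
    case False
    have "poly [:- \<theta> i / (\<theta> j - \<theta> i), 1 / (\<theta> j - \<theta> i):] (\<theta> i) = 0" by (simp add: field_simps)
    then have "poly (L j) (\<theta> i) = 0" unfolding L_def poly_prod
      using that False by (intro prod_zero) (auto intro!: bexI[of _ i])
    then show ?thesis using False by simp
  qed
  have interpolation: "p = (\<Sum>j\<le>m. smult (poly p (\<theta> j)) (L j))" if "degree p \<le> m" for p
  proof (rule poly_eqI_degree[where A = "\<theta> ` {..m}"])
    fix x assume "x \<in> \<theta> ` {..m}"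
    then obtain i where i: "i \<le> m" "x = \<theta> i" by auto
    have "(\<Sum>j\<le>m. poly p (\<theta> j) * poly (L j) (\<theta> i)) = (\<Sum>j\<le>m. if i = j then poly p (\<theta> j) else 0)"
      using i poly_L by (intro sum.cong) auto
    then show "poly p x = poly (\<Sum>j\<le>m. smult (poly p (\<theta> j)) (L j)) x"
      using i by (simp add: poly_sum sum.delta')
  next
    have "degree (\<Sum>j\<le>m. smult (poly p (\<theta> j)) (L j)) \<le> m"
      by (intro degree_sum_le) (auto intro: order_trans[OF degree_smult_le] deg_L)
    then show "degree (\<Sum>j\<le>m. smult (poly p (\<theta> j)) (L j)) < card (\<theta> ` {..m})"
      using inj by (simp add: card_image)
  qed (use that inj in \<open>simp add: card_image\<close>)
  have "poly p z = (\<Sum>j\<le>m. poly (L j) z * poly p (\<theta> j))" if "degree p \<le> m" for p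
    using arg_cong[OF interpolation[OF that], of "\<lambda>q. poly q z"] by (simp add: poly_sum mult.commute)
  then show thesis by (rule that)
qed

text \<open>
  This reduces an extrapolation in space to an extrapolation in one variable, without any
  multivariate interpolation.
\<close>

lemma poly_space_along_line:
  assumes "p \<in> poly_space m K"
  obtains P where "degree P \<le> m" "\<And>s. z + s *\<^sub>R d \<in> K \<Longrightarrow> p (z + s *\<^sub>R d) = poly P s"
proof -
  obtain c where c: "\<And>x. x \<in> K \<Longrightarrow> p x = (\<Sum>\<alpha> | (\<Sum>i\<in>UNIV. \<alpha> i) \<le> m. c \<alpha> * monomial \<alpha> x)"
    using assms by (auto simp: poly_space_def)
  define M where "M \<alpha> = (\<Prod>i\<in>UNIV. [:z $ i, d $ i:] ^ \<alpha> i)" for \<alpha> :: "3 \<Rightarrow> nat"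
  have deg_M: "degree (M \<alpha>) \<le> (\<Sum>i\<in>UNIV. \<alpha> i)" for \<alpha>
  proof -
    have "degree (M \<alpha>) \<le> (\<Sum>i\<in>UNIV. degree ([:z $ i, d $ i:] ^ \<alpha> i))"
      unfolding M_def by (rule order_trans[OF degree_prod_sum_le]) (simp_all add: o_def)
    also have "\<dots> \<le> (\<Sum>i\<in>UNIV. \<alpha> i)"
    proof (rule sum_mono)
      fix i
      have "degree ([:z $ i, d $ i:] ^ \<alpha> i) \<le> degree [:z $ i, d $ i:] * \<alpha> i"
        by (rule degree_power_le)
      also have "\<dots> \<le> \<alpha> i" by simp
      finally show "degree ([:z $ i, d $ i:] ^ \<alpha> i) \<le> \<alpha> i" .
    qed
    finally show ?thesis .
  qed
  define P where "P = (\<Sum>\<alpha> | (\<Sum>i\<in>UNIV. \<alpha> i) \<le> m. smult (c \<alpha>) (M \<alpha>))"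
  have "degree P \<le> m" unfolding P_def
    by (intro degree_sum_le finite_multiindices)
      (auto intro: order_trans[OF degree_smult_le] order_trans[OF deg_M])
  moreover have "p (z + s *\<^sub>R d) = poly P s" if "z + s *\<^sub>R d \<in> K" for s
    using c[OF that] by (simp add: P_def M_def monomial_def poly_sum poly_prod)
  ultimately show thesis by (rule that)
qed

lemma continuous_on_poly_space:
  assumes "p \<in> poly_space m K"
  shows "continuous_on K p"
proof -
  obtain c where c: "\<And>x. x \<in> K \<Longrightarrow> p x = (\<Sum>\<alpha> | (\<Sum>i\<in>UNIV. \<alpha> i) \<le> m. c \<alpha> * monomial \<alpha> x)"
    using assms by (auto simp: poly_space_def)
  have "continuous_on K (\<lambda>x. \<Sum>\<alpha> | (\<Sum>i\<in>UNIV. \<alpha> i) \<le> m. c \<alpha> * monomial \<alpha> x)"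
    unfolding monomial_def by (intro continuous_intros)
  then show ?thesis using c by (simp cong: continuous_on_cong)
qed

lemma poly_space_lincomb:
  fixes p :: "'i::finite \<Rightarrow> real^3 \<Rightarrow> real"
  assumes "\<And>i. p i \<in> poly_space m K"
  shows "(\<lambda>x. \<Sum>i\<in>UNIV. p i x * k i) \<in> poly_space m K"
proof -
  have "\<exists>c. \<forall>x\<in>K. p i x = (\<Sum>\<alpha> | (\<Sum>i\<in>UNIV. \<alpha> i) \<le> m. c \<alpha> * monomial \<alpha> x)" for i
    using assms[of i] by (auto simp: poly_space_def)
  then obtain c where c: "\<And>i x. x \<in> K \<Longrightarrow>
      p i x = (\<Sum>\<alpha> | (\<Sum>i\<in>UNIV. \<alpha> i) \<le> m. c i \<alpha> * monomial \<alpha> x)"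
    by metis
  have "(\<Sum>i\<in>UNIV. p i x * k i)
      = (\<Sum>\<alpha> | (\<Sum>i\<in>UNIV. \<alpha> i) \<le> m. (\<Sum>i\<in>UNIV. c i \<alpha> * k i) * monomial \<alpha> x)" if "x \<in> K" for x
  proof -
    have "(\<Sum>i\<in>UNIV. p i x * k i)
        = (\<Sum>i\<in>UNIV. \<Sum>\<alpha> | (\<Sum>i\<in>UNIV. \<alpha> i) \<le> m. c i \<alpha> * k i * monomial \<alpha> x)"
      by (simp add: c[OF that] sum_distrib_left sum_distrib_right mult_ac)
    also have "\<dots> = (\<Sum>\<alpha> | (\<Sum>i\<in>UNIV. \<alpha> i) \<le> m. \<Sum>i\<in>UNIV. c i \<alpha> * k i * monomial \<alpha> x)"
      by (rule sum.swap)
    finally show ?thesis by (simp add: sum_distrib_right)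
  qed
  moreover have "p i x = 0" if "x \<notin> K" for i x
    using assms[of i] that by (auto simp: poly_space_def)
  ultimately show ?thesis unfolding poly_space_def by (auto intro!: exI)
qed

lemma set_integrable_compact:
  fixes f :: "'a::euclidean_space \<Rightarrow> real"
  assumes "compact K" "continuous_on K f"
  shows "set_integrable lborel K f"
  unfolding set_integrable_def by (rule borel_integrable_compact[OF assms])

lemma convex_dilation_mem:
  fixes z :: "'a::real_vector"
  assumes "convex K" "z \<in> K" "x \<in> K" "0 \<le> \<theta>" "\<theta> \<le> 1"
  shows "z + \<theta> *\<^sub>R (x - z) \<in> K"
proof -
  have "z + \<theta> *\<^sub>R (x - z) = (1 - \<theta>) *\<^sub>R z + \<theta> *\<^sub>R x" by (simp add: algebra_simps)
  then show ?thesis using assms by (simp add: convexD)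
qed

text \<open>
  The dilation with centre \<open>z\<close> maps \<open>K\<close> into itself, so that the substitution turns the
  left-hand side into the integral over a subset of \<open>K\<close>.
\<close>

lemma set_integral_dilation_le:
  fixes f :: "'a::euclidean_space \<Rightarrow> real" and z :: 'a
  assumes K: "compact K" "convex K" "z \<in> K" and \<theta>: "0 < \<theta>" "\<theta> \<le> 1"
    and f: "continuous_on K f" "\<And>x. x \<in> K \<Longrightarrow> 0 \<le> f x"
  shows "(LINT x:K|lborel. f (z + \<theta> *\<^sub>R (x - z))) \<le> (LINT x:K|lborel. f x) / \<theta> ^ DIM('a)"
proof -
  define g where "g x = indicator K x *\<^sub>R f x" for x
  define T where "T x = (z - \<theta> *\<^sub>R z) + \<theta> *\<^sub>R x" for x
  have int_g: "integrable lborel g"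
    unfolding g_def by (rule borel_integrable_compact) fact+
  have [measurable]: "g \<in> borel_measurable borel"
    using borel_measurable_integrable[OF int_g] by simp
  have [measurable]: "T \<in> borel_measurable borel" unfolding T_def by measurable
  have lb: "lborel = density (distr lborel borel T) (\<lambda>_. \<theta> ^ DIM('a))"
    using lborel_affine[of \<theta> "z - \<theta> *\<^sub>R z"] \<theta> by (simp add: T_def[abs_def])
  have int_gT: "integrable lborel (\<lambda>x. g (T x))"
  proof -
    have "integrable (density (distr lborel borel T) (\<lambda>_. \<theta> ^ DIM('a))) g"
      using int_g lb by simp
    then show ?thesis using \<theta>
      by (simp add: integrable_density integrable_distr_eq)
  qed
  have "integral\<^sup>L lborel g = integral\<^sup>L (density (distr lborel borel T) (\<lambda>_. \<theta> ^ DIM('a))) g"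
    using lb by simp
  also have "\<dots> = \<theta> ^ DIM('a) * integral\<^sup>L lborel (\<lambda>x. g (T x))"
    using \<theta> by (simp add: integral_density integral_distr)
  finally have change: "integral\<^sup>L lborel (\<lambda>x. g (T x)) = integral\<^sup>L lborel g / \<theta> ^ DIM('a)"
    using \<theta> by (simp add: field_simps)
  have T_eq: "T x = z + \<theta> *\<^sub>R (x - z)" for x by (simp add: T_def algebra_simps)
  have "(LINT x|lborel. indicator K x *\<^sub>R f (T x)) \<le> integral\<^sup>L lborel (\<lambda>x. g (T x))"
  proof (rule integral_mono'[OF int_gT])
    fix x
    show "indicator K x *\<^sub>R f (T x) \<le> g (T x)"
      using convex_dilation_mem[OF K(2,3), of x \<theta>] \<theta> f(2)
      by (auto simp: g_def T_eq indicator_def)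
    show "0 \<le> g (T x)" using f(2) by (auto simp: g_def indicator_def)
  qed
  then show ?thesis
    unfolding set_lebesgue_integral_def change unfolding T_eq g_def[abs_def] .
qed

lemma set_integral_mono_continuous:
  fixes f g :: "'a::euclidean_space \<Rightarrow> real"
  assumes "compact K" "continuous_on K f" "continuous_on K g" "\<And>x. x \<in> K \<Longrightarrow> f x \<le> g x"
  shows "(LINT x:K|lborel. f x) \<le> (LINT x:K|lborel. g x)"
  using assms by (intro set_integral_mono set_integrable_compact)

lemma set_integral_sum_continuous:
  fixes f :: "'i \<Rightarrow> 'a::euclidean_space \<Rightarrow> real"
  assumes "compact K" "finite I" "\<And>i. i \<in> I \<Longrightarrow> continuous_on K (f i)"
  shows "(LINT x:K|lborel. (\<Sum>i\<in>I. f i x)) = (\<Sum>i\<in>I. LINT x:K|lborel. f i x)"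
proof -
  have "integrable lborel (\<lambda>x. indicator K x *\<^sub>R f i x)" if "i \<in> I" for i
    using set_integrable_compact[OF assms(1) assms(3)[OF that]] by (simp add: set_integrable_def)
  then show ?thesis
    unfolding set_lebesgue_integral_def scaleR_sum_right by (intro Bochner_Integration.integral_sum)
qed

text \<open>
  A polynomial of degree at most \<open>m\<close> is controlled on \<open>K\<close> by its values on the copy of \<open>K\<close>
  shrunk by one half towards \<open>z\<close>: on each ray from \<open>z\<close> it is a polynomial of one variable,
  extrapolated from dilation factors in \<open>(0, 1/2]\<close> to the factor \<open>1\<close>. Hence a weight that
  vanishes on the boundary costs only a constant, provided that it is at least \<open>\<delta>\<close> on the
  shrunk copy. The interpolation nodes are dilation factors, so the constant depends on \<open>m\<close>
  alone and not on \<open>K\<close>.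
\<close>

theorem polynomial_L2_le_weighted_L2:
  "\<exists>C>0. \<forall>K z p w \<delta>. compact K \<longrightarrow> convex K \<longrightarrow> z \<in> K \<longrightarrow> p \<in> poly_space m K \<longrightarrow>
     continuous_on K w \<longrightarrow> (\<forall>x\<in>K. 0 \<le> w x) \<longrightarrow>
     (\<forall>x\<in>K. \<forall>\<theta>. 0 < \<theta> \<longrightarrow> \<theta> \<le> 1/2 \<longrightarrow> \<delta> \<le> w (z + \<theta> *\<^sub>R (x - z))) \<longrightarrow>
     \<delta> * (LINT x:K|lborel. (p x)\<^sup>2) \<le> C * (LINT x:K|lborel. w x * (p x)\<^sup>2)"
proof -
  define \<theta> :: "nat \<Rightarrow> real" where "\<theta> j = 1 / (real j + 2)" for j
  have \<theta>: "0 < \<theta> j" "\<theta> j \<le> 1/2" for j by (auto simp: \<theta>_def field_simps)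
  have "inj_on \<theta> {..m}" by (auto simp: inj_on_def \<theta>_def field_simps)
  then obtain \<omega> where \<omega>:
      "\<And>P. degree P \<le> m \<Longrightarrow> poly P 1 = (\<Sum>j\<le>m. \<omega> j * poly P (\<theta> j))"
    by (rule extrapolation_weights) blast
  \<comment> \<open>Cauchy--Schwarz for the extrapolation formula gives the factor
    \<open>W\<close>, and the Jacobians of the dilations give the inverse cubes. Adding
    \<open>1\<close> makes \<open>C\<close> positive.\<close>
  define W where "W = (\<Sum>j\<le>m. (\<omega> j)\<^sup>2)"
  define C where "C = W * (\<Sum>j\<le>m. 1 / \<theta> j ^ 3) + 1"
  have W: "W \<ge> 0" by (simp add: W_def sum_nonneg)
  have "C > 0" unfolding C_def using W \<theta>
    by (intro add_nonneg_pos mult_nonneg_nonneg sum_nonneg) (auto simp: less_imp_le)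
  moreover have "\<delta> * (LINT x:K|lborel. (p x)\<^sup>2) \<le> C * (LINT x:K|lborel. w x * (p x)\<^sup>2)"
    if K: "compact K" "convex K" "z \<in> K" and p: "p \<in> poly_space m K"
      and w: "continuous_on K w" "\<forall>x\<in>K. 0 \<le> w x"
      and \<delta>: "\<forall>x\<in>K. \<forall>\<theta>. 0 < \<theta> \<longrightarrow> \<theta> \<le> 1/2 \<longrightarrow> \<delta> \<le> w (z + \<theta> *\<^sub>R (x - z))"
    for K z p w \<delta>
  proof (cases "\<delta> \<le> 0")
    case True
    have "0 \<le> (LINT x:K|lborel. w x * (p x)\<^sup>2)" "0 \<le> (LINT x:K|lborel. (p x)\<^sup>2)"
      using w by (auto simp: set_lebesgue_integral_def indicator_def intro!: integral_nonneg_AE)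
    then show ?thesis using True \<open>C > 0\<close>
      by (meson mult_nonneg_nonneg mult_nonpos_nonneg less_imp_le order_trans)
  next
    case False
    define g where "g x = w x * (p x)\<^sup>2" for x
    define T where "T j x = z + \<theta> j *\<^sub>R (x - z)" for j x
    have TK: "T j x \<in> K" if "x \<in> K" for j x
      unfolding T_def using K that \<theta>[of j] by (intro convex_dilation_mem) auto
    have cont_p: "continuous_on K p" using p by (rule continuous_on_poly_space)
    have cont_g: "continuous_on K g" unfolding g_def by (intro continuous_intros w cont_p)
    have cont_gT: "continuous_on K (\<lambda>x. g (T j x))" for j
      by (rule continuous_on_compose2[OF cont_g]) (auto simp: T_def intro!: continuous_intros TK[unfolded T_def])
    have g0: "g x \<ge> 0" if "x \<in> K" for x using w that by (simp add: g_def)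
    have pointwise: "\<delta> * (p x)\<^sup>2 \<le> (\<Sum>j\<le>m. W * g (T j x))" if x: "x \<in> K" for x
    proof -
      obtain P where P: "degree P \<le> m" "\<And>s. z + s *\<^sub>R (x - z) \<in> K \<Longrightarrow> p (z + s *\<^sub>R (x - z)) = poly P s"
        using poly_space_along_line[OF p] by blast
      have "p x = poly P 1" using P(2)[of 1] x by simp
      also have "\<dots> = (\<Sum>j\<le>m. \<omega> j * p (T j x))"
        using P(2) TK[OF x] by (simp add: \<omega>[OF P(1)] T_def)
      finally have "(p x)\<^sup>2 \<le> W * (\<Sum>j\<le>m. (p (T j x))\<^sup>2)"
        unfolding W_def by (simp add: Cauchy_Schwarz_ineq_sum)
      then have "\<delta> * (p x)\<^sup>2 \<le> \<delta> * (W * (\<Sum>j\<le>m. (p (T j x))\<^sup>2))"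
        using False by (intro mult_left_mono) auto
      also have "\<dots> = (\<Sum>j\<le>m. W * (\<delta> * (p (T j x))\<^sup>2))"
        by (simp add: sum_distrib_left mult_ac)
      also have "\<dots> \<le> (\<Sum>j\<le>m. W * g (T j x))"
        using \<delta> x \<theta> W unfolding g_def T_def
        by (intro sum_mono mult_left_mono mult_right_mono) auto
      finally show ?thesis .
    qed
    have "\<delta> * (LINT x:K|lborel. (p x)\<^sup>2) = (LINT x:K|lborel. \<delta> * (p x)\<^sup>2)" by simp
    also have "\<dots> \<le> (LINT x:K|lborel. (\<Sum>j\<le>m. W * g (T j x)))"
      by (intro set_integral_mono_continuous K continuous_intros cont_p cont_gT pointwise)
    also have "\<dots> = (\<Sum>j\<le>m. W * (LINT x:K|lborel. g (T j x)))"
      by (subst set_integral_sum_continuous) (auto intro!: continuous_intros cont_gT K)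
    also have "\<dots> \<le> (\<Sum>j\<le>m. W * ((LINT x:K|lborel. g x) / \<theta> j ^ 3))"
    proof (intro sum_mono mult_left_mono W)
      fix j
      show "(LINT x:K|lborel. g (T j x)) \<le> (LINT x:K|lborel. g x) / \<theta> j ^ 3"
        unfolding T_def using set_integral_dilation_le[OF K \<theta>(1) _ cont_g g0, of j] \<theta>(2)[of j] by simp
    qed
    also have "\<dots> = (C - 1) * (LINT x:K|lborel. g x)"
      by (simp add: C_def sum_distrib_left sum_distrib_right mult_ac)
    also have "\<dots> \<le> C * (LINT x:K|lborel. g x)"
      using g0 by (auto simp: set_lebesgue_integral_def indicator_def intro!: mult_right_mono integral_nonneg_AE)
    finally show ?thesis by (simp add: g_def)
  qed
  ultimately show ?thesis by blast
qed


text \<open>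
  This makes the \<open>L\<^sup>2\<close> norm definite on continuous functions. Points on the boundary
  of \<open>K\<close> are included because a convex body is the closure of its interior.
\<close>

lemma set_integral_eq_0_imp_0:
  fixes f :: "'a::euclidean_space \<Rightarrow> real"
  assumes K: "compact K" "convex K" "interior K \<noteq> {}"
    and f: "continuous_on K f" "\<And>x. x \<in> K \<Longrightarrow> 0 \<le> f x"
    and int0: "(LINT x:K|lborel. f x) = 0" and x: "x \<in> K"
  shows "f x = 0"
proof -
  have cl: "closure (interior K) = K"
    using K by (simp add: convex_closure_interior closure_closed compact_imp_closed)
  have "frontier K \<in> null_sets lborel"
    using negligible_convex_frontier[OF K(2)]
    by (auto simp: negligible_iff_null_sets null_sets_completion_iff)
  then have null: "K - interior K \<in> null_sets lborel"
    using K by (simp add: frontier_def closure_closed compact_imp_closed)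
  have "emeasure lborel (interior K \<union> (K - interior K)) = emeasure lborel (interior K)"
    using null by (intro emeasure_Un_null_set) auto
  moreover have "interior K \<union> (K - interior K) = K" using interior_subset by blast
  ultimately have regular: "emeasure lborel K = emeasure lborel (interior K)" by simp
  have "interior K \<notin> null_sets lborel"
    using open_not_negligible[OF open_interior K(3)]
    by (auto simp: negligible_iff_null_sets null_sets_completion_iff)
  then have pos: "emeasure lborel (interior K) > 0"
    by (auto simp: null_sets_def zero_less_iff_neq_zero)
  have finite: "emeasure lborel (interior K) < \<infinity>"
    using regular emeasure_compact_finite[OF K(1)] by simp
  have "(f has_integral 0) K"
    using set_borel_integral_eq_integral[OF set_integrable_compact[OF K(1) f(1)]] int0
    by (simp add: has_integral_iff)
  then show ?thesis
    using has_integral_0_closure_imp_0[of "interior K" f x] f x pos finite regular cl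
      interior_subset[of K] by (simp add: subset_iff)
qed

section \<open>Barycentric coordinates and edge tangents of a tetrahedron\<close>

text \<open>
  The numerals \<open>0\<close> and \<open>4\<close> denote the same element of the type \<open>4\<close>; the vertices are listed
  here as in the definition of the bubble functions.
\<close>

lemma UNIV_4_from_0: "(UNIV :: 4 set) = insert 0 {1, 2, 3}"
proof -
  have "(4::4) = 0" by simp
  then show ?thesis using UNIV_4 by (metis insert_commute)
qed

lemma vertex_numbering_simplex:
  assumes "n simplex K" "vertex_numbering a K"
  shows "inj a" "\<not> affine_dependent (range a)" "K = convex hull (range a)"
proof -
  obtain C where C: "\<not> affine_dependent C" "K = convex hull C"
    using assms(1) by (auto simp: simplex_def)
  have "{x. x extreme_point_of K} = C"
    using C extreme_point_of_convex_hull_affine_independent by auto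
  then have "bij_betw a UNIV C" using assms(2) by (simp add: vertex_numbering_def)
  then show "inj a" "\<not> affine_dependent (range a)" "K = convex hull (range a)"
    using C by (auto simp: bij_betw_def)
qed

text \<open>
  Affine independence of a set, transferred to an injective enumeration of it, since barycentric
  coordinates are indexed by vertex numbers and not by points.
\<close>

lemma affine_independent_family:
  fixes a :: "'i::finite \<Rightarrow> 'a::real_vector"
  assumes "inj a" "\<not> affine_dependent (range a)"
    and "(\<Sum>j\<in>UNIV. l j) = 0" "(\<Sum>j\<in>UNIV. l j *\<^sub>R a j) = 0"
  shows "l i = 0"
proof (rule ccontr)
  assume "l i \<noteq> 0"
  define U where "U v = l (inv a v)" for v
  have [simp]: "U (a j) = l j" for j using assms(1) by (simp add: U_def)
  have "sum U (range a) = 0" "(\<Sum>v\<in>range a. U v *\<^sub>R v) = 0"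
    using assms by (simp_all add: sum.reindex)
  moreover have "\<exists>v\<in>range a. U v \<noteq> 0" using \<open>l i \<noteq> 0\<close> by auto
  ultimately show False
    using assms(2) affine_dependent_explicit_finite[of "range a"] by auto
qed

lemma mem_convex_hull_range:
  fixes a :: "'i::finite \<Rightarrow> 'a::real_vector"
  assumes "inj a"
  shows "x \<in> convex hull (range a) \<longleftrightarrow>
    (\<exists>l. (\<forall>j. 0 \<le> l j) \<and> (\<Sum>j\<in>UNIV. l j) = 1 \<and> (\<Sum>j\<in>UNIV. l j *\<^sub>R a j) = x)"
proof
  assume "x \<in> convex hull (range a)"
  then obtain u where "\<forall>v\<in>range a. 0 \<le> u v" "sum u (range a) = 1" "(\<Sum>v\<in>range a. u v *\<^sub>R v) = x"
    by (auto simp: convex_hull_finite)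
  then show "\<exists>l. (\<forall>j. 0 \<le> l j) \<and> (\<Sum>j\<in>UNIV. l j) = 1 \<and> (\<Sum>j\<in>UNIV. l j *\<^sub>R a j) = x"
    using assms by (intro exI[of _ "u \<circ> a"]) (simp add: sum.reindex)
next
  assume "\<exists>l. (\<forall>j. 0 \<le> l j) \<and> (\<Sum>j\<in>UNIV. l j) = 1 \<and> (\<Sum>j\<in>UNIV. l j *\<^sub>R a j) = x"
  then obtain l where l: "\<forall>j. 0 \<le> l j" "(\<Sum>j\<in>UNIV. l j) = 1" "(\<Sum>j\<in>UNIV. l j *\<^sub>R a j) = x"
    by blast
  have "(\<Sum>j\<in>UNIV. l j *\<^sub>R a j) \<in> convex hull (range a)"
    by (rule convex_sum) (use l in \<open>auto intro: hull_inc\<close>)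
  then show "x \<in> convex hull (range a)" using l by simp
qed

text \<open>
  The geometric content of a vertex numbering of a nondegenerate tetrahedron.
\<close>

locale numbered_tetrahedron =
  fixes a :: "4 \<Rightarrow> real^3" and K :: "(real^3) set"
  assumes inj_a: "inj a"
    and indep: "\<not> affine_dependent (range a)"
    and K_hull: "K = convex hull (range a)"
begin

lemma compact_K: "compact K" and convex_K: "convex K"
  by (simp_all add: K_hull finite_imp_compact_convex_hull)

lemma vertex_in_K: "a i \<in> K"
  by (simp add: K_hull hull_inc)

lemma barycentric_unique:
  assumes "(\<Sum>j\<in>UNIV. l j) = 1" "(\<Sum>j\<in>UNIV. l j *\<^sub>R a j) = x"
  shows "barycentric a i x = l i"
proof -
  have unique: "l' = l" if "(\<Sum>j\<in>UNIV. l' j) = 1 \<and> (\<Sum>j\<in>UNIV. l' j *\<^sub>R a j) = x" for l'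
  proof
    fix i
    have "l' i - l i = 0"
      using that assms
      by (intro affine_independent_family[OF inj_a indep, of "\<lambda>j. l' j - l j"])
        (simp_all add: sum_subtractf scaleR_left_diff_distrib)
    then show "l' i = l i" by simp
  qed
  have "(THE l. (\<Sum>j\<in>UNIV. l j) = 1 \<and> (\<Sum>j\<in>UNIV. l j *\<^sub>R a j) = x) = l"
  proof (rule the_equality)
    show "(\<Sum>j\<in>UNIV. l j) = 1 \<and> (\<Sum>j\<in>UNIV. l j *\<^sub>R a j) = x" using assms ..
  qed (rule unique)
  then show ?thesis by (simp add: barycentric_def)
qed

lemma barycentric_on_K:
  assumes "x \<in> K"
  shows "0 \<le> barycentric a i x" "(\<Sum>j\<in>UNIV. barycentric a j x) = 1"
    "(\<Sum>j\<in>UNIV. barycentric a j x *\<^sub>R a j) = x"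
proof -
  obtain l where l: "\<forall>j. 0 \<le> l j" "(\<Sum>j\<in>UNIV. l j) = 1" "(\<Sum>j\<in>UNIV. l j *\<^sub>R a j) = x"
    using assms mem_convex_hull_range[OF inj_a] K_hull by auto
  have "barycentric a j x = l j" for j by (rule barycentric_unique[of l, OF l(2,3)])
  then show "0 \<le> barycentric a i x" "(\<Sum>j\<in>UNIV. barycentric a j x) = 1"
    "(\<Sum>j\<in>UNIV. barycentric a j x *\<^sub>R a j) = x" using l by simp_all
qed

lemma barycentric_le_1:
  assumes "x \<in> K"
  shows "barycentric a i x \<le> 1"
  using member_le_sum[of i UNIV "\<lambda>j. barycentric a j x"] barycentric_on_K(1,2)[OF assms] by simp

text \<open>
  The map from coordinates to the pair of the point and the sum of the coordinates is linear and,
  by affine independence, injective. On \<open>K\<close> the coordinates are therefore given by a linear left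
  inverse of it, evaluated at \<open>(x, 1)\<close>.
\<close>

lemma continuous_on_barycentric: "continuous_on K (barycentric a i)"
proof -
  define T :: "real^4 \<Rightarrow> (real^3) \<times> real" where
    "T l = ((\<Sum>j\<in>UNIV. (l $ j) *\<^sub>R a j), (\<Sum>j\<in>UNIV. l $ j))" for l
  have lin: "linear T"
    by (rule linearI)
      (simp_all add: T_def sum.distrib scaleR_left_distrib scaleR_sum_right sum_distrib_left)
  have "inj T"
  proof (subst linear_injective_0[OF lin], intro allI impI)
    fix l assume "T l = 0"
    then have "l $ i = 0" for i
      using affine_independent_family[OF inj_a indep, of "\<lambda>j. l $ j"]
      by (simp add: T_def zero_prod_def)
    then show "l = 0" by (simp add: vec_eq_iff)
  qed
  then obtain g where g: "linear g" "g \<circ> T = id"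
    using linear_injective_left_inverse[OF lin] by blast
  have "barycentric a i x = g (x, 1) $ i" if "x \<in> K" for x
  proof -
    have "T (\<chi> j. barycentric a j x) = (x, 1)"
      using barycentric_on_K[OF that] by (simp add: T_def)
    then have "g (x, 1) = (\<chi> j. barycentric a j x)"
      using g(2) by (metis comp_apply id_apply)
    then show ?thesis by simp
  qed
  moreover have "continuous_on K (\<lambda>x. g (x, 1) $ i)"
    by (intro continuous_intros linear_continuous_on_compose[OF _ g(1)])
  ultimately show ?thesis by (simp cong: continuous_on_cong)
qed

definition centroid :: "real^3" where
  "centroid = (\<Sum>j\<in>UNIV. (1/4) *\<^sub>R a j)"

lemma centroid_in_K: "centroid \<in> K"
  unfolding K_hull mem_convex_hull_range[OF inj_a] centroid_def
  by (intro exI[of _ "\<lambda>_. 1/4"]) simp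

text \<open>
  Barycentric coordinates are affine and all equal to \<open>1/4\<close> at the centroid; moving from there
  at most halfway to a point of \<open>K\<close> keeps at least half of that value.
\<close>

lemma barycentric_near_centroid:
  assumes "x \<in> K" "0 < \<theta>" "\<theta> \<le> 1/2"
  shows "1/8 \<le> barycentric a i (centroid + \<theta> *\<^sub>R (x - centroid))"
proof -
  let ?l = "\<lambda>j. (1 - \<theta>) / 4 + \<theta> * barycentric a j x"
  have "barycentric a i (centroid + \<theta> *\<^sub>R (x - centroid)) = ?l i"
  proof (rule barycentric_unique[of ?l])
    show "(\<Sum>j\<in>UNIV. ?l j) = 1"
      using barycentric_on_K[OF assms(1)] by (simp add: sum.distrib flip: sum_distrib_left) (simp add: field_simps)
    have "(\<Sum>j\<in>UNIV. ?l j *\<^sub>R a j)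
        = (1 - \<theta>) *\<^sub>R centroid + \<theta> *\<^sub>R (\<Sum>j\<in>UNIV. barycentric a j x *\<^sub>R a j)"
      by (simp add: centroid_def scaleR_left_distrib sum.distrib scaleR_sum_right)
    then show "(\<Sum>j\<in>UNIV. ?l j *\<^sub>R a j) = centroid + \<theta> *\<^sub>R (x - centroid)"
      using barycentric_on_K[OF assms(1)] by (simp add: algebra_simps)
  qed
  moreover have "0 \<le> \<theta> * barycentric a i x"
    using barycentric_on_K[OF assms(1)] assms by simp
  moreover have "1/8 \<le> (1 - \<theta>) / 4" using assms by simp
  ultimately show ?thesis by linarith
qed

lemma bubble_weight_bounds:
  assumes "x \<in> K"
  shows "0 \<le> barycentric a 0 x * barycentric a i x" "barycentric a 0 x * barycentric a i x \<le> 1"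
  using barycentric_on_K(1)[OF assms] barycentric_le_1[OF assms] by (simp_all add: mult_le_one)

lemma norm_unit_tangent: "i \<noteq> 0 \<Longrightarrow> norm (unit_tangent a 0 i) = 1"
  using injD[OF inj_a, of i 0] by (cases "a i = a 0") (auto simp: unit_tangent_def)

text \<open>
  A quantitative form of the fact that the three edges at vertex \<open>0\<close> span the space. The two
  ends of the diameter of the ball in the direction of \<open>q\<close> differ by a combination of the edge
  vectors whose coefficients are differences of barycentric coordinates, hence at most \<open>1\<close>
  in absolute value. Taking the inner product with \<open>q\<close> gives the bound.
\<close>

lemma norm_le_tangential_components:
  assumes ball: "cball x \<rho> \<subseteq> K" "\<rho> > 0"
  shows "2 * \<rho> * norm q \<le> diameter K * (\<Sum>i\<in>{1,2,3}. \<bar>q \<bullet> unit_tangent a 0 i\<bar>)"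
proof (cases "q = 0")
  case False
  define u where "u = q /\<^sub>R norm q"
  define y y' where "y = x + \<rho> *\<^sub>R u" and "y' = x - \<rho> *\<^sub>R u"
  have "norm u = 1" using False by (simp add: u_def)
  then have K: "y \<in> K" "y' \<in> K"
    using ball by (auto simp: y_def y'_def dist_norm subset_iff)
  define \<Delta> where "\<Delta> i = barycentric a i y - barycentric a i y'" for i
  have \<Delta>: "\<bar>\<Delta> i\<bar> \<le> 1" for i
    using barycentric_on_K(1)[OF K(1), of i] barycentric_on_K(1)[OF K(2), of i]
      barycentric_le_1[OF K(1), of i] barycentric_le_1[OF K(2), of i]
    by (simp add: \<Delta>_def)
  have sum0: "(\<Sum>i\<in>UNIV. \<Delta> i) = 0"
    using K by (simp add: \<Delta>_def sum_subtractf barycentric_on_K)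
  have "(2 * \<rho>) *\<^sub>R u = y - y'" by (simp add: y_def y'_def flip: scaleR_left_distrib)
  also have "\<dots> = (\<Sum>i\<in>UNIV. \<Delta> i *\<^sub>R a i)"
    using K by (simp add: \<Delta>_def sum_subtractf scaleR_left_diff_distrib barycentric_on_K)
  also have "\<dots> = (\<Sum>i\<in>UNIV. \<Delta> i *\<^sub>R (a i - a 0))"
    using sum0 by (simp add: sum_subtractf scaleR_right_diff_distrib flip: scaleR_sum_left)
  also have "\<dots> = (\<Sum>i\<in>{1,2,3}. \<Delta> i *\<^sub>R (a i - a 0))"
  proof (rule sum.mono_neutral_right)
    have "i = 0" if "i \<notin> {1, 2, 3}" for i :: 4 using that UNIV_4_from_0 by blast
    then show "\<forall>i\<in>UNIV - {1, 2, 3}. \<Delta> i *\<^sub>R (a i - a 0) = 0" by force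
  qed auto
  finally have "q \<bullet> ((2 * \<rho>) *\<^sub>R u) = (\<Sum>i\<in>{1,2,3}. \<Delta> i * (q \<bullet> (a i - a 0)))"
    by (simp only: inner_sum_right inner_scaleR_right)
  moreover have "q \<bullet> ((2 * \<rho>) *\<^sub>R u) = 2 * \<rho> * norm q"
    using False by (simp add: u_def dot_square_norm power2_eq_square)
  moreover have "(\<Sum>i\<in>{1,2,3}. \<Delta> i * (q \<bullet> (a i - a 0)))
      \<le> (\<Sum>i\<in>{1,2,3}. diameter K * \<bar>q \<bullet> unit_tangent a 0 i\<bar>)"
  proof (rule sum_mono)
    fix i :: 4 assume "i \<in> {1,2,3}"
    then have "i \<noteq> 0" by auto
    then have "a i \<noteq> a 0" using injD[OF inj_a, of i 0] by blast
    then have "norm (a i - a 0) *\<^sub>R unit_tangent a 0 i = a i - a 0"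
      by (simp add: unit_tangent_def)
    then have eq: "q \<bullet> (a i - a 0) = norm (a i - a 0) * (q \<bullet> unit_tangent a 0 i)"
      by (simp only: flip: inner_scaleR_right)
    have "\<Delta> i * (q \<bullet> (a i - a 0)) \<le> \<bar>\<Delta> i\<bar> * (norm (a i - a 0) * \<bar>q \<bullet> unit_tangent a 0 i\<bar>)"
      unfolding eq using abs_ge_self[of "\<Delta> i * (norm (a i - a 0) * (q \<bullet> unit_tangent a 0 i))"]
      by (simp only: abs_mult abs_norm_cancel)
    also have "\<dots> \<le> 1 * (diameter K * \<bar>q \<bullet> unit_tangent a 0 i\<bar>)"
      using diameter_bounded_bound[OF compact_imp_bounded[OF compact_K] vertex_in_K[of i] vertex_in_K[of 0]] \<Delta>
      by (intro mult_mono) (auto simp: dist_norm intro!: diameter_ge_0 compact_imp_bounded compact_K)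
    finally show "\<Delta> i * (q \<bullet> (a i - a 0)) \<le> diameter K * \<bar>q \<bullet> unit_tangent a 0 i\<bar>" by simp
  qed
  ultimately show ?thesis unfolding sum_distrib_left by linarith
qed (auto intro!: mult_nonneg_nonneg diameter_ge_0 compact_imp_bounded compact_K)

lemma diameter_pos: "diameter K > 0"
proof -
  have "0 < dist (a 0) (a 1)" using injD[OF inj_a, of 0 1] by force
  also have "\<dots> \<le> diameter K"
    by (intro diameter_bounded_bound compact_imp_bounded compact_K vertex_in_K)
  finally show ?thesis .
qed

text \<open>
  Half of the supremum defining the inscribed diameter is smaller than the diameter of some ball
  in \<open>K\<close>, whence the factor \<open>4\<close> instead of \<open>2\<close>.
\<close>

lemma inscribed_ball:
  assumes "diameter K \<le> \<sigma> * inball_diameter K"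
  obtains x \<rho> where "0 < \<sigma>" "0 < \<rho>" "cball x \<rho> \<subseteq> K" "diameter K \<le> 4 * \<sigma> * \<rho>"
proof -
  define S where "S = {2 * \<rho> | \<rho>. 0 \<le> \<rho> \<and> (\<exists>x. cball x \<rho> \<subseteq> K)}"
  have "bdd_above S"
  proof (rule bdd_aboveI)
    fix s assume "s \<in> S"
    then obtain \<rho> x where \<rho>: "s = 2 * \<rho>" "0 \<le> \<rho>" "cball x \<rho> \<subseteq> K" by (auto simp: S_def)
    then show "s \<le> diameter K"
      using diameter_subset[OF \<rho>(3) compact_imp_bounded[OF compact_K]] by simp
  qed
  moreover have "0 \<in> S"
  proof -
    have "cball (a 0) 0 \<subseteq> K" using vertex_in_K[of 0] by simp
    then show ?thesis by (force simp: S_def)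
  qed
  moreover have Sup: "inball_diameter K = Sup S" by (simp add: inball_diameter_def S_def)
  ultimately have "0 \<le> inball_diameter K" by (simp add: cSup_upper)
  moreover have "0 < \<sigma> * inball_diameter K" using assms diameter_pos by linarith
  ultimately have \<sigma>: "0 < \<sigma>" and pos: "0 < inball_diameter K"
    by (auto simp: zero_less_mult_iff)
  obtain s where "s \<in> S" "inball_diameter K / 2 < s"
    using less_cSupE[of "inball_diameter K / 2" S] pos Sup \<open>0 \<in> S\<close> by auto
  then obtain \<rho> x where \<rho>: "cball x \<rho> \<subseteq> K" "inball_diameter K < 4 * \<rho>" by (auto simp: S_def)
  have "diameter K \<le> \<sigma> * (4 * \<rho>)"
    using assms mult_left_mono[of "inball_diameter K" "4 * \<rho>" \<sigma>] \<rho> \<sigma> by linarith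
  then show thesis using that[OF \<sigma> _ \<rho>(1)] pos \<rho> by (simp add: mult_ac)
qed

end


section \<open>The inf-sup condition\<close>

lemma L2_inner_pos:
  assumes K: "compact K" "convex K" "interior K \<noteq> {}"
    and f: "continuous_on K f" "y \<in> K" "f y \<noteq> 0"
  shows "L2_inner K f f > 0"
proof -
  have "L2_inner K f f \<noteq> 0"
    using set_integral_eq_0_imp_0[OF K, of "\<lambda>x. f x \<bullet> f x" y] f
    by (auto simp: L2_inner_def intro!: continuous_intros)
  moreover have "L2_inner K f f \<ge> 0"
    by (auto simp: L2_inner_def set_lebesgue_integral_def indicator_def intro!: integral_nonneg_AE)
  ultimately show ?thesis by simp
qed

text \<open>
  The test function is \<open>v = \<Sum>\<^sub>i (q \<bullet> t\<^sub>i) b\<^sub>i\<close>. With the weights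
  \<open>w\<^sub>i = \<lambda>\<^sub>0 \<lambda>\<^sub>i\<close>, its inner product \<open>A\<close> with \<open>q\<close> is a weighted sum of squares of
  the tangential components. Since \<open>w\<^sub>i \<le> 1\<close>, the square of the norm of \<open>v\<close> is at
  most \<open>3 A\<close>. Conversely the square of the norm of \<open>q\<close> is at most \<open>768 \<sigma>\<^sup>2 C A\<close>:
  the tangential components control \<open>q\<close> by shape regularity, and dropping the weights costs \<open>64 C\<close>.
  The constant in the conclusion comes from \<open>3 * 768 = 48\<^sup>2\<close>.
  The second assumption on \<open>C\<close> is the polynomial estimate for dilations about the centroid,
  where each weight is at least \<open>1/8 * 1/8 = 1/64\<close>.
\<close>

lemma (in numbered_tetrahedron) inf_sup_witness:
  assumes q: "q \<in> D_space r K" "q \<noteq> (\<lambda>x. 0)"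
    and reg: "diameter K \<le> \<sigma> * inball_diameter K"
    and C: "C > 0" "\<And>p w. p \<in> poly_space (r - 1) K \<Longrightarrow> continuous_on K w \<Longrightarrow> (\<forall>x\<in>K. 0 \<le> w x) \<Longrightarrow>
      (\<forall>x\<in>K. \<forall>\<theta>. 0 < \<theta> \<longrightarrow> \<theta> \<le> 1/2 \<longrightarrow> 1/64 \<le> w (centroid + \<theta> *\<^sub>R (x - centroid))) \<Longrightarrow>
      1/64 * (LINT x:K|lborel. (p x)\<^sup>2) \<le> C * (LINT x:K|lborel. w x * (p x)\<^sup>2)"
  obtains v where "v \<in> B_div_space r a K" "v \<noteq> (\<lambda>x. 0)"
    "1 / (48 * \<sigma> * sqrt C) \<le> L2_inner K v q / (L2_norm K v * L2_norm K q)"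
proof -
  obtain z \<rho> where ball: "0 < \<sigma>" "0 < \<rho>" "cball z \<rho> \<subseteq> K" "diameter K \<le> 4 * \<sigma> * \<rho>"
    using inscribed_ball[OF reg] by blast
  define I :: "4 set" where "I = {1, 2, 3}"
  have I: "finite I" "card I = 3" "\<And>i. i \<in> I \<Longrightarrow> i \<noteq> 0" by (auto simp: I_def)
  define p where "p i x = q x \<bullet> unit_tangent a 0 i" for i x
  define w where "w i x = barycentric a 0 x * barycentric a i x" for i x
  define v where "v x = (\<Sum>i\<in>I. p i x *\<^sub>R div_bubble a i x)" for x
  have p_poly: "p i \<in> poly_space (r - 1) K" for i
    using poly_space_lincomb[of "\<lambda>k x. q x $ k" "r - 1" K "\<lambda>k. unit_tangent a 0 i $ k"] q(1)
    by (simp add: D_space_def p_def[abs_def] inner_vec_def)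
  have cont_p: "continuous_on K (p i)" for i by (rule continuous_on_poly_space[OF p_poly])
  have cont_w: "continuous_on K (w i)" for i
    unfolding w_def by (intro continuous_intros continuous_on_barycentric)
  have "continuous_on K (\<lambda>x. q x $ i)" for i
    using q(1) by (auto simp: D_space_def intro: continuous_on_poly_space)
  then have "continuous_on K (\<lambda>x. \<chi> i. q x $ i)" by (rule continuous_on_vec_lambda)
  then have cont_q: "continuous_on K q" by simp
  have v_eq: "v x = (\<Sum>i\<in>I. (w i x * p i x) *\<^sub>R unit_tangent a 0 i)" for x
    by (simp add: v_def div_bubble_def w_def mult_ac)
  have cont_v: "continuous_on K v"
    unfolding v_eq[abs_def] by (intro continuous_intros cont_w cont_p)
  have w: "0 \<le> w i x" "w i x \<le> 1" if "x \<in> K" for i x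
    using bubble_weight_bounds[OF that] by (simp_all add: w_def)
  have w_core: "1/64 \<le> w i (centroid + \<theta> *\<^sub>R (x - centroid))" if "x \<in> K" "0 < \<theta>" "\<theta> \<le> 1/2" for i \<theta> x
  proof -
    have "1/8 * (1/8) \<le> w i (centroid + \<theta> *\<^sub>R (x - centroid))"
      unfolding w_def using barycentric_near_centroid[OF that] order_trans[OF _ barycentric_near_centroid[OF that]]
      by (intro mult_mono) auto
    then show ?thesis by simp
  qed
  define A where "A = L2_inner K v q"
  define N where "N = L2_inner K q q"
  have inner_vq: "v x \<bullet> q x = (\<Sum>i\<in>I. w i x * (p i x)\<^sup>2)" for x
    unfolding v_eq inner_sum_left
    by (intro sum.cong) (simp_all add: p_def power2_eq_square inner_commute)
  have A_eq: "A = (\<Sum>i\<in>I. LINT x:K|lborel. w i x * (p i x)\<^sup>2)"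
    unfolding A_def L2_inner_def inner_vq
    by (intro set_integral_sum_continuous compact_K I(1) continuous_intros cont_w cont_p)
  have norm_v: "L2_inner K v v \<le> 3 * A"
  proof -
    have "v x \<bullet> v x \<le> 3 * (v x \<bullet> q x)" if x: "x \<in> K" for x
    proof -
      have "norm (v x) \<le> (\<Sum>i\<in>I. norm ((w i x * p i x) *\<^sub>R unit_tangent a 0 i))"
        unfolding v_eq by (rule norm_sum)
      also have "\<dots> = (\<Sum>i\<in>I. \<bar>w i x * p i x\<bar>)"
        using I(3) by (intro sum.cong) (simp_all add: norm_unit_tangent)
      finally have "(norm (v x))\<^sup>2 \<le> (\<Sum>i\<in>I. \<bar>w i x * p i x\<bar>)\<^sup>2" by (intro power_mono) auto
      also have "\<dots> \<le> (\<Sum>i\<in>I. \<bar>w i x * p i x\<bar>\<^sup>2) * card I" by (rule sum_squared_le_sum_of_squares)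
      also have "\<dots> = 3 * (\<Sum>i\<in>I. (w i x)\<^sup>2 * (p i x)\<^sup>2)"
        using I by (simp add: power_mult_distrib)
      also have "\<dots> \<le> 3 * (\<Sum>i\<in>I. w i x * (p i x)\<^sup>2)"
        using w[OF x] by (intro mult_left_mono sum_mono mult_right_mono)
          (simp_all add: power2_eq_square mult_left_le)
      finally show ?thesis by (simp add: inner_vq power2_norm_eq_inner)
    qed
    then have "L2_inner K v v \<le> (LINT x:K|lborel. 3 * (v x \<bullet> q x))"
      unfolding L2_inner_def
      by (intro set_integral_mono_continuous compact_K continuous_intros cont_v cont_q)
    then show ?thesis by (simp add: A_def L2_inner_def)
  qed
  have coercive: "N \<le> 768 * \<sigma>\<^sup>2 * C * A"
  proof -
    have "q x \<bullet> q x \<le> (\<Sum>i\<in>I. 12 * \<sigma>\<^sup>2 * (p i x)\<^sup>2)" for x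
    proof -
      have "2 * \<rho> * norm (q x) \<le> diameter K * (\<Sum>i\<in>I. \<bar>p i x\<bar>)"
        using norm_le_tangential_components[OF ball(3,2)] by (simp only: p_def I_def)
      also have "\<dots> \<le> (4 * \<sigma> * \<rho>) * (\<Sum>i\<in>I. \<bar>p i x\<bar>)"
        by (intro mult_right_mono ball sum_nonneg) auto
      finally have "2 * \<rho> * norm (q x) \<le> 2 * \<rho> * (2 * \<sigma> * (\<Sum>i\<in>I. \<bar>p i x\<bar>))"
        by (simp only: mult_ac)
      then have "norm (q x) \<le> 2 * \<sigma> * (\<Sum>i\<in>I. \<bar>p i x\<bar>)"
        by (rule mult_left_le_imp_le) (use ball in simp)
      then have "(norm (q x))\<^sup>2 \<le> (2 * \<sigma> * (\<Sum>i\<in>I. \<bar>p i x\<bar>))\<^sup>2" by (intro power_mono) auto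
      also have "\<dots> = 4 * \<sigma>\<^sup>2 * (\<Sum>i\<in>I. \<bar>p i x\<bar>)\<^sup>2" by (simp add: power_mult_distrib)
      also have "\<dots> \<le> 4 * \<sigma>\<^sup>2 * ((\<Sum>i\<in>I. \<bar>p i x\<bar>\<^sup>2) * card I)"
        by (intro mult_left_mono sum_squared_le_sum_of_squares) auto
      also have "\<dots> = (\<Sum>i\<in>I. 12 * \<sigma>\<^sup>2 * (p i x)\<^sup>2)" using I by (simp add: sum_distrib_left mult_ac)
      finally show ?thesis by (simp add: power2_norm_eq_inner)
    qed
    then have "N \<le> (LINT x:K|lborel. (\<Sum>i\<in>I. 12 * \<sigma>\<^sup>2 * (p i x)\<^sup>2))"
      unfolding N_def L2_inner_def
      by (intro set_integral_mono_continuous compact_K continuous_intros cont_q cont_p)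
    also have "\<dots> = (\<Sum>i\<in>I. LINT x:K|lborel. 12 * \<sigma>\<^sup>2 * (p i x)\<^sup>2)"
      by (intro set_integral_sum_continuous compact_K I(1) continuous_intros cont_p)
    also have "\<dots> = (\<Sum>i\<in>I. 768 * \<sigma>\<^sup>2 * (1/64 * (LINT x:K|lborel. (p i x)\<^sup>2)))" by (simp add: mult_ac)
    also have "\<dots> \<le> (\<Sum>i\<in>I. 768 * \<sigma>\<^sup>2 * (C * (LINT x:K|lborel. w i x * (p i x)\<^sup>2)))"
      using w w_core by (intro sum_mono mult_left_mono C p_poly cont_w) auto
    also have "\<dots> = 768 * \<sigma>\<^sup>2 * C * A" by (simp add: A_eq sum_distrib_left mult_ac)
    finally show ?thesis .
  qed
  have int_K: "interior K \<noteq> {}"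
    using interior_mono[OF ball(3)] ball(2) by (auto simp: interior_cball)
  have N_pos: "N > 0"
  proof -
    obtain y where y: "q y \<noteq> 0" using q(2) by auto
    then have "y \<in> K"
      using q(1) by (auto simp: D_space_def poly_space_def vec_eq_iff)
    then show ?thesis
      unfolding N_def using y by (intro L2_inner_pos compact_K convex_K int_K cont_q)
  qed
  then have "0 < (768 * \<sigma>\<^sup>2 * C) * A" using coercive by linarith
  moreover have "0 < 768 * \<sigma>\<^sup>2 * C" using ball(1) C(1) by simp
  ultimately have A_pos: "A > 0" by (rule zero_less_mult_pos)
  have "v \<in> B_div_space r a K"
    unfolding B_div_space_def v_def I_def using p_poly[of 1] p_poly[of 2] p_poly[of 3]
    by (auto simp: add.assoc)
  moreover have v_nz: "v \<noteq> (\<lambda>x. 0)" using A_pos by (auto simp: A_def L2_inner_def)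
  moreover have "1 / (48 * \<sigma> * sqrt C) \<le> A / (L2_norm K v * L2_norm K q)"
  proof -
    \<comment> \<open>The quotient would be \<open>0\<close> by convention if the norm of
      \<open>v\<close> were \<open>0\<close>; this is excluded because \<open>v\<close> has a
      positive inner product with \<open>q\<close>.\<close>
    obtain y where "y \<in> K" "v y \<noteq> 0"
    proof (rule ccontr)
      assume "\<not> thesis"
      then have "v x = 0" if "x \<in> K" for x using \<open>\<And>y. y \<in> K \<Longrightarrow> v y \<noteq> 0 \<Longrightarrow> thesis\<close> that by blast
      then have "indicator K x *\<^sub>R (v x \<bullet> q x) = 0" for x by (simp add: indicator_def)
      then have "A = 0" by (simp only: A_def L2_inner_def set_lebesgue_integral_def integral_zero)
      then show False using A_pos by simp
    qed
    then have "L2_inner K v v > 0" by (intro L2_inner_pos compact_K convex_K int_K cont_v)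
    then have pos: "0 < L2_norm K v * L2_norm K q"
      using N_pos by (simp add: L2_norm_def N_def)
    have "L2_norm K v * L2_norm K q = sqrt (L2_inner K v v * N)"
      by (simp add: L2_norm_def N_def real_sqrt_mult)
    also have "\<dots> \<le> sqrt (3 * A * (768 * \<sigma>\<^sup>2 * C * A))"
      using norm_v coercive N_pos A_pos by (intro real_sqrt_le_mono mult_mono) auto
    also have "3 * A * (768 * \<sigma>\<^sup>2 * C * A) = (48 * \<sigma> * A)\<^sup>2 * C"
      by (simp add: power2_eq_square)
    also have "sqrt \<dots> = 48 * \<sigma> * A * sqrt C"
      using ball(1) A_pos by (simp add: real_sqrt_mult)
    finally show ?thesis
      using pos ball(1) C(1) by (simp add: divide_simps mult_ac)
  qed
  ultimately show thesis using that by (simp add: A_def)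
qed

theorem lemma4p2:
  fixes r :: nat and \<sigma> :: real
  assumes "r \<ge> 1"
  shows "\<exists>c>0. \<forall>(\<Omega> :: (real^3) set) (\<T> :: (real^3) set set).
           tetrahedral_mesh \<T> \<Omega> \<and> shape_regular \<sigma> \<T> \<longrightarrow>
           (\<forall>K\<in>\<T>. \<forall>a. vertex_numbering a K \<longrightarrow>
              inf_sup K (D_space r K) (B_div_space r a K) \<ge> ereal c)"
proof -
  obtain C where "C > 0" and C: "\<And>K z p w \<delta>. compact K \<Longrightarrow> convex K \<Longrightarrow> z \<in> K \<Longrightarrow>
     p \<in> poly_space (r - 1) K \<Longrightarrow> continuous_on K w \<Longrightarrow> (\<forall>x\<in>K. 0 \<le> w x) \<Longrightarrow>
     (\<forall>x\<in>K. \<forall>\<theta>. 0 < \<theta> \<longrightarrow> \<theta> \<le> 1/2 \<longrightarrow> \<delta> \<le> w (z + \<theta> *\<^sub>R (x - z))) \<Longrightarrow>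
     \<delta> * (LINT x:K|lborel. (p x)\<^sup>2) \<le> C * (LINT x:K|lborel. w x * (p x)\<^sup>2)"
    using polynomial_L2_le_weighted_L2[of "r - 1"] by blast
  \<comment> \<open>For \<open>\<sigma> \<le> 0\<close> a shape-regular tetrahedral mesh has no elements, so
    the value chosen is irrelevant.\<close>
  define c where "c = (if \<sigma> > 0 then 1 / (48 * \<sigma> * sqrt C) else 1)"
  have "c > 0" using \<open>C > 0\<close> by (simp add: c_def)
  moreover have "ereal c \<le> inf_sup K (D_space r K) (B_div_space r a K)"
    if mesh: "tetrahedral_mesh \<T> \<Omega>" "shape_regular \<sigma> \<T>" "K \<in> \<T>" and a: "vertex_numbering a K"
    for \<T> \<Omega> K a
  proof -
    have "3 simplex K" using mesh by (simp add: tetrahedral_mesh_def)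
    then interpret numbered_tetrahedron a K
      using vertex_numbering_simplex[OF _ a] by unfold_locales
    have reg: "diameter K \<le> \<sigma> * inball_diameter K" using mesh by (simp add: shape_regular_def)
    have "\<sigma> > 0" using inscribed_ball[OF reg] by blast
    show ?thesis unfolding inf_sup_def
    proof (rule INF_greatest)
      fix q assume "q \<in> D_space r K - {\<lambda>x. 0}"
      then have q: "q \<in> D_space r K" "q \<noteq> (\<lambda>x. 0)" by auto
      obtain v where "v \<in> B_div_space r a K" "v \<noteq> (\<lambda>x. 0)"
          "1 / (48 * \<sigma> * sqrt C) \<le> L2_inner K v q / (L2_norm K v * L2_norm K q)"
        using inf_sup_witness[OF q reg \<open>C > 0\<close> C[OF compact_K convex_K centroid_in_K]] by blast
      then show "ereal c \<le> (SUP v \<in> B_div_space r a K - {\<lambda>x. 0}.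
          ereal (L2_inner K v q / (L2_norm K v * L2_norm K q)))"
        using \<open>\<sigma> > 0\<close> by (intro SUP_upper2[of v]) (auto simp: c_def)
    qed
  qed
  ultimately show ?thesis by blast
qed

end
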